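(* Let $u:D\times\Gamma\to\mathbb{R}$ have the ANOVA decomposition $u(x,\mu)=u_0(x)+\sum_{\emptyset\neq T\subseteq U}u_T(x,\mu_T)$. Let $x\in D$ and let $T\subseteq U=\{1,\ldots,N\}$ with $|T|>0$. Assume that the $|T|$-th order component function $u_T(x,\mu_T)$, regarded as a function of $\mu\in\Gamma$, belongs to $L^2_\rho(\Gamma)$. Then the generalized polynomial chaos expansion of $u_T(x,\mu_T)$ can be expressed as $$u_T(x,\mu_T)=\sum_{\mathbf{i}\in\mathfrak{M}_T}u_{\mathbf{i}}(x)\,\Phi_{\mathbf{i}}(\mu)\qquad\text{(in } L^2_\rho(\Gamma)\text{)},$$ where the coefficient $u_{\mathbf{i}}(x)$ of $\Phi_{\mathbf{i}}(\mu)$ is $$u_{\mathbf{i}}(x)=\int_\Gamma\rho(\mu)\,u_T(x,\mu_T)\,\Phi_{\mathbf{i}}(\mu)\,d\mu .$$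
   Context: Setting. $D\subseteq\mathbb{R}^d$ ($d=2,3$) is a bounded connected physical domain with polygonal boundary. $\mu=(\mu_1,\ldots,\mu_N)$ is a random vector with mutually independent components; $\Gamma_k\subseteq\mathbb{R}$ is the image of $\mu_k$ and $\rho_k$ its probability density function. Thus $\Gamma=\Gamma_1\times\cdots\times\Gamma_N$ is the image of $\mu$, and its density is $\rho(\mu)=\prod_{k=1}^N\rho_k(\mu_k)$. $L^2_\rho(\Gamma)$ is the Hilbert space of functions $g:\Gamma\to\mathbb{R}$ with $\int_\Gamma\rho\,g^2\,d\mu<\infty$, with inner product $\int_\Gamma\rho\,g\,\hat g\,d\mu$. Subsets of variables. $U=\{1,\ldots,N\}$. For nonempty $T=\{t_1<\cdots<t_{|T|}\}\subseteq U$, $\mu_T=(\mu_{t_1},\ldots,\mu_{t_{|T|}})$, and $T^c=U\setminus T$. ANOVA decomposition. A representation $u(x,\mu)=u_0(x)+\sum_{\emptyset\neq T\subseteq U}u_T(x,\mu_T)$ is called an ANOVA decomposition of $u$ if (i) $u_0(x)=\int_\Gamma\rho(\mu)u(x,\mu)\,d\mu$, and (ii) for every nonempty $T\subseteq U$ and every $t\in T$, $\int_{\Gamma_t}\rho_t(\mu_t)\,u_T(x,\mu_T)\,d\mu_t=0$ (for almost every value of the remaining variables). The function $u_T(x,\mu_T)$ is called the $|T|$-th order component function. gPC basis. For each $k$, $\{\phi^{(k)}_i\}_{i\ge0}$ are the univariate orthonormal polynomials for $\rho_k$: $\phi^{(k)}_i$ is a polynomial of degree $i$, $\phi^{(k)}_0=1$,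 and $\int_{\Gamma_k}\rho_k\,\phi^{(k)}_i\phi^{(k)}_j\,d\mu_k=\delta_{i,j}$. For a multi-index $\mathbf{i}=(i_1,\ldots,i_N)\in\mathbb{N}^N$ ($0\in\mathbb{N}$), $\Phi_{\mathbf{i}}(\mu)=\phi^{(1)}_{i_1}(\mu_1)\cdots\phi^{(N)}_{i_N}(\mu_N)$. Standing assumption: $\{\Phi_{\mathbf{i}}\}_{\mathbf{i}\in\mathbb{N}^N}$ is a complete orthonormal basis of $L^2_\rho(\Gamma)$; the generalized polynomial chaos (gPC) expansion of $g\in L^2_\rho(\Gamma)$ is its expansion in this basis. Index sets. For nonempty $T\subseteq U$, $\mathfrak{M}_T=\{\mathbf{i}\in\mathbb{N}^N : i_t\neq0\text{ for all }t\in T,\ i_s=0\text{ for all }s\in T^c\}$. *)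

theory Defs
  imports "HOL-Probability.Probability" "HOL-Computational_Algebra.Polynomial"
begin

definition polygonal_domain :: "(real ^ 'd) set \<Rightarrow> bool" where
  "polygonal_domain D \<longleftrightarrow>
     open D \<and> connected D \<and> bounded D \<and>
     (\<exists>F. finite F \<and> (\<forall>P\<in>F. polytope P \<and> aff_dim P = int CARD('d) - 1) \<and> frontier D = \<Union>F)"

text \<open>The variables are indexed by \<open>{1..N}\<close>.  For \<open>K \<subseteq> {1..N}\<close>, a point of
  \<open>\<Prod>\<^sub>k\<^sub>\<in>\<^sub>K \<Gamma>\<^sub>k\<close> is a function that is \<open>undefined\<close> outside \<open>K\<close>, so that the subvector
  \<open>\<mu>\<^sub>T\<close> is \<open>restrict \<mu> T\<close>, and Lebesgue measure on it is the product \<open>leb K\<close>.\<close>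

abbreviation leb :: "nat set \<Rightarrow> (nat \<Rightarrow> real) measure" where
  "leb K \<equiv> PiM K (\<lambda>_. lborel)"

definition joint_density :: "(nat \<Rightarrow> real \<Rightarrow> real) \<Rightarrow> nat set \<Rightarrow> (nat \<Rightarrow> real) \<Rightarrow> real" where
  "joint_density \<rho> K \<mu> = (\<Prod>k\<in>K. \<rho> k (\<mu> k))"

definition L2_space ::
  "nat \<Rightarrow> (nat \<Rightarrow> real set) \<Rightarrow> (nat \<Rightarrow> real \<Rightarrow> real) \<Rightarrow> ((nat \<Rightarrow> real) \<Rightarrow> real) set" where
  "L2_space N \<Gamma> \<rho> =
     {g. set_borel_measurable (leb {1..N}) (PiE {1..N} \<Gamma>) g \<and>
         set_integrable (leb {1..N}) (PiE {1..N} \<Gamma>) (\<lambda>\<mu>. joint_density \<rho> {1..N} \<mu> * (g \<mu>)\<^sup>2)}"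

definition L2_inner ::
  "nat \<Rightarrow> (nat \<Rightarrow> real set) \<Rightarrow> (nat \<Rightarrow> real \<Rightarrow> real) \<Rightarrow>
   ((nat \<Rightarrow> real) \<Rightarrow> real) \<Rightarrow> ((nat \<Rightarrow> real) \<Rightarrow> real) \<Rightarrow> real" where
  "L2_inner N \<Gamma> \<rho> g h =
     (LINT \<mu>:PiE {1..N} \<Gamma>|leb {1..N}. joint_density \<rho> {1..N} \<mu> * g \<mu> * h \<mu>)"

definition L2_norm ::
  "nat \<Rightarrow> (nat \<Rightarrow> real set) \<Rightarrow> (nat \<Rightarrow> real \<Rightarrow> real) \<Rightarrow> ((nat \<Rightarrow> real) \<Rightarrow> real) \<Rightarrow> real" where
  "L2_norm N \<Gamma> \<rho> g = sqrt (L2_inner N \<Gamma> \<rho> g g)"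

text \<open>Unconditional convergence in \<open>L\<^sup>2\<^sub>\<rho>(\<Gamma>)\<close>.  The library's \<open>has_sum\<close> does not apply because
  the elements are represented by functions, not by a type carrying the \<open>L\<^sup>2\<close> topology.\<close>

definition L2_has_sum ::
  "nat \<Rightarrow> (nat \<Rightarrow> real set) \<Rightarrow> (nat \<Rightarrow> real \<Rightarrow> real) \<Rightarrow>
   ('i \<Rightarrow> (nat \<Rightarrow> real) \<Rightarrow> real) \<Rightarrow> 'i set \<Rightarrow> ((nat \<Rightarrow> real) \<Rightarrow> real) \<Rightarrow> bool" where
  "L2_has_sum N \<Gamma> \<rho> f I g \<longleftrightarrow>
     g \<in> L2_space N \<Gamma> \<rho> \<and> (\<forall>i\<in>I. f i \<in> L2_space N \<Gamma> \<rho>) \<and>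
     ((\<lambda>F. L2_norm N \<Gamma> \<rho> (\<lambda>\<mu>. g \<mu> - (\<Sum>i\<in>F. f i \<mu>))) \<longlongrightarrow> 0) (finite_subsets_at_top I)"

text \<open>Completeness of the system means that its linear span is dense in \<open>L\<^sup>2\<^sub>\<rho>(\<Gamma>)\<close>.\<close>

definition complete_orthonormal_basis ::
  "nat \<Rightarrow> (nat \<Rightarrow> real set) \<Rightarrow> (nat \<Rightarrow> real \<Rightarrow> real) \<Rightarrow>
   ('i \<Rightarrow> (nat \<Rightarrow> real) \<Rightarrow> real) \<Rightarrow> 'i set \<Rightarrow> bool" where
  "complete_orthonormal_basis N \<Gamma> \<rho> e I \<longleftrightarrow>
     (\<forall>i\<in>I. e i \<in> L2_space N \<Gamma> \<rho>) \<and>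
     (\<forall>i\<in>I. \<forall>j\<in>I. L2_inner N \<Gamma> \<rho> (e i) (e j) = (if i = j then 1 else 0)) \<and>
     (\<forall>g\<in>L2_space N \<Gamma> \<rho>. \<forall>\<epsilon>>0. \<exists>F c. finite F \<and> F \<subseteq> I \<and>
        L2_norm N \<Gamma> \<rho> (\<lambda>\<mu>. g \<mu> - (\<Sum>i\<in>F. c i * e i \<mu>)) < \<epsilon>)"

definition orthonormal_polynomials ::
  "real set \<Rightarrow> (real \<Rightarrow> real) \<Rightarrow> (nat \<Rightarrow> real poly) \<Rightarrow> bool" where
  "orthonormal_polynomials G r p \<longleftrightarrow>
     (\<forall>i. degree (p i) = i) \<and> p 0 = 1 \<and>
     (\<forall>i j. set_integrable lborel G (\<lambda>s. r s * poly (p i) s * poly (p j) s) \<and>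
            (LINT s:G|lborel. r s * poly (p i) s * poly (p j) s) = (if i = j then 1 else 0))"

definition multi_indices :: "nat \<Rightarrow> (nat \<Rightarrow> nat) set" where
  "multi_indices N = (PiE {1..N} (\<lambda>_. UNIV))"

definition multi_indices_on :: "nat \<Rightarrow> nat set \<Rightarrow> (nat \<Rightarrow> nat) set" where
  "multi_indices_on N T =
     {i \<in> multi_indices N. (\<forall>t\<in>T. i t \<noteq> 0) \<and> (\<forall>s\<in>{1..N} - T. i s = 0)}"

definition gpc_basis ::
  "nat \<Rightarrow> (nat \<Rightarrow> nat \<Rightarrow> real poly) \<Rightarrow> (nat \<Rightarrow> nat) \<Rightarrow> (nat \<Rightarrow> real) \<Rightarrow> real" where
  "gpc_basis N \<phi> i \<mu> = (\<Prod>k\<in>{1..N}. poly (\<phi> k (i k)) (\<mu> k))"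

definition gpc_expansion ::
  "nat \<Rightarrow> (nat \<Rightarrow> real set) \<Rightarrow> (nat \<Rightarrow> real \<Rightarrow> real) \<Rightarrow> (nat \<Rightarrow> nat \<Rightarrow> real poly) \<Rightarrow>
   ((nat \<Rightarrow> real) \<Rightarrow> real) \<Rightarrow> ((nat \<Rightarrow> nat) \<Rightarrow> real) \<Rightarrow> bool" where
  "gpc_expansion N \<Gamma> \<rho> \<phi> g c \<longleftrightarrow>
     L2_has_sum N \<Gamma> \<rho> (\<lambda>i \<mu>. c i * gpc_basis N \<phi> i \<mu>) (multi_indices N) g"

text \<open>The last condition is required for almost every value \<open>y\<close> of the remaining variables with
  respect to their joint distribution, that is, for Lebesgue-almost every point of
  \<open>\<Prod>\<^sub>k\<^sub>\<in>\<^sub>T\<^sub>-\<^sub>{\<^sub>t\<^sub>} \<Gamma>\<^sub>k\<close> at which the density is positive.  The \<open>set_integrable\<close> conjuncts exclude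
  the default value \<open>0\<close> of the integral of a non-integrable function.\<close>

definition anova_decomposition ::
  "nat \<Rightarrow> (nat \<Rightarrow> real set) \<Rightarrow> (nat \<Rightarrow> real \<Rightarrow> real) \<Rightarrow> 'x set \<Rightarrow> ('x \<Rightarrow> (nat \<Rightarrow> real) \<Rightarrow> real) \<Rightarrow>
   ('x \<Rightarrow> real) \<Rightarrow> (nat set \<Rightarrow> 'x \<Rightarrow> (nat \<Rightarrow> real) \<Rightarrow> real) \<Rightarrow> bool" where
  "anova_decomposition N \<Gamma> \<rho> D u u\<^sub>0 u\<^sub>T \<longleftrightarrow>
     (\<forall>x\<in>D. \<forall>\<mu>\<in>PiE {1..N} \<Gamma>. u x \<mu> = u\<^sub>0 x + (\<Sum>T\<in>Pow {1..N} - {{}}. u\<^sub>T T x (restrict \<mu> T))) \<and>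
     (\<forall>x\<in>D. set_integrable (leb {1..N}) (PiE {1..N} \<Gamma>) (\<lambda>\<mu>. joint_density \<rho> {1..N} \<mu> * u x \<mu>) \<and>
        u\<^sub>0 x = (LINT \<mu>:PiE {1..N} \<Gamma>|leb {1..N}. joint_density \<rho> {1..N} \<mu> * u x \<mu>)) \<and>
     (\<forall>x\<in>D. \<forall>T. T \<noteq> {} \<and> T \<subseteq> {1..N} \<longrightarrow> (\<forall>t\<in>T.
        AE y in leb (T - {t}). y \<in> PiE (T - {t}) \<Gamma> \<longrightarrow> 0 < joint_density \<rho> (T - {t}) y \<longrightarrow>
          set_integrable lborel (\<Gamma> t) (\<lambda>s. \<rho> t s * u\<^sub>T T x (y(t := s))) \<and>
          (LINT s:\<Gamma> t|lborel. \<rho> t s * u\<^sub>T T x (y(t := s))) = 0))"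

end

theory Submission
  imports Defs
begin

text \<open>
  Put \<open>g \<mu> = u\<^sub>T(x, \<mu>\<^sub>T)\<close>.  By completeness \<open>g\<close> is the sum of its Fourier series, whose
  coefficients are \<open>\<langle>g, \<Phi>\<^sub>i\<rangle>\<close>, so everything rests on showing that these coefficients vanish for every
  multi-index \<open>i\<close> outside \<open>\<MM>\<^sub>T\<close>.  Such an \<open>i\<close> fails in one of two ways, and in each of them a single
  inner integral in Fubini's theorem is already zero.

  If \<open>i\<^sub>s \<noteq> 0\<close> for some \<open>s \<notin> T\<close>, then \<open>g\<close> does not depend on \<open>\<mu>\<^sub>s\<close>, and the integral over \<open>\<mu>\<^sub>s\<close> is a
  multiple of \<open>\<integral> \<rho>\<^sub>s p = \<integral> \<rho>\<^sub>s p \<cdot> 1\<close> with \<open>p\<close> the orthonormal polynomial of degree \<open>i\<^sub>s\<close>; this is zero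
  because \<open>p\<close> is orthogonal to the polynomial \<open>1\<close> of degree \<open>0\<close> (\<open>L2_inner_eq_0_off_support\<close>).  If \<open>i\<^sub>t = 0\<close> for some
  \<open>t \<in> T\<close>, then \<open>\<Phi>\<^sub>i\<close> does not depend on \<open>\<mu>\<^sub>t\<close>, and the integral over \<open>\<mu>\<^sub>t\<close> is a multiple of
  \<open>\<integral> \<rho>\<^sub>t u\<^sub>T d\<mu>\<^sub>t\<close>, which is zero by the defining condition of the ANOVA decomposition
  (\<open>L2_inner_eq_0_on_support\<close>).

  The passage from the coefficients to convergence is the usual best-approximation argument
  (\<open>L2_has_sum_coefficients\<close>): truncating the Fourier series to a finite set minimises the distance
  among all combinations supported there, enlarging the set only lowers the distance, and indices
  with zero coefficient may be left out.  It is carried out for functions, with a positive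
  semidefinite form in place of an inner product.
\<close>

section \<open>The weighted space as a semi-inner-product space\<close>

locale product_weight =
  fixes N :: nat and \<Gamma> :: "nat \<Rightarrow> real set" and \<rho> :: "nat \<Rightarrow> real \<Rightarrow> real"
  assumes Gamma_borel: "k \<in> {1..N} \<Longrightarrow> \<Gamma> k \<in> sets borel"
    and rho_borel: "k \<in> {1..N} \<Longrightarrow> \<rho> k \<in> borel_measurable borel"
    and rho_nonneg: "k \<in> {1..N} \<Longrightarrow> 0 \<le> \<rho> k s"
begin

lemma joint_density_nonneg: "K \<subseteq> {1..N} \<Longrightarrow> 0 \<le> joint_density \<rho> K \<mu>"
  unfolding joint_density_def by (intro prod_nonneg) (auto intro!: rho_nonneg)

lemma joint_density_measurable:
  "joint_density \<rho> {1..N} \<in> borel_measurable (leb {1..N})"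
proof -
  have "(\<lambda>\<mu>. \<rho> k (\<mu> k)) \<in> borel_measurable (leb {1..N})" if k: "k \<in> {1..N}" for k
  proof -
    have "(\<lambda>\<mu>. \<mu> k) \<in> measurable (leb {1..N}) lborel"
      by (rule measurable_component_singleton[OF k])
    moreover have "\<rho> k \<in> borel_measurable lborel"
      using rho_borel[OF k] by simp
    ultimately show ?thesis by (rule measurable_compose)
  qed
  then show ?thesis
    unfolding joint_density_def[abs_def] by (intro borel_measurable_prod) auto
qed

lemma image_measurable: "PiE {1..N} \<Gamma> \<in> sets (leb {1..N})"
  by (intro sets_PiM_I_finite) (auto intro!: Gamma_borel)

lemma weighted_product_integrable:
  assumes "g \<in> L2_space N \<Gamma> \<rho>" and "h \<in> L2_space N \<Gamma> \<rho>"
  shows "set_integrable (leb {1..N}) (PiE {1..N} \<Gamma>)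
           (\<lambda>\<mu>. joint_density \<rho> {1..N} \<mu> * g \<mu> * h \<mu>)"
proof -
  let ?A = "PiE {1..N} \<Gamma>" and ?w = "joint_density \<rho> {1..N}" and ?P = "leb {1..N}"
  have gm: "(\<lambda>\<mu>. indicator ?A \<mu> * g \<mu>) \<in> borel_measurable ?P"
    and hm: "(\<lambda>\<mu>. indicator ?A \<mu> * h \<mu>) \<in> borel_measurable ?P"
    and gi: "set_integrable ?P ?A (\<lambda>\<mu>. ?w \<mu> * (g \<mu>)\<^sup>2)"
    and hi: "set_integrable ?P ?A (\<lambda>\<mu>. ?w \<mu> * (h \<mu>)\<^sup>2)"
    using assms by (auto simp: L2_space_def set_borel_measurable_def)
  have bound: "set_integrable ?P ?A (\<lambda>\<mu>. ?w \<mu> * (g \<mu>)\<^sup>2 + ?w \<mu> * (h \<mu>)\<^sup>2)"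
    by (rule set_integral_add(1)[OF gi hi])
  have "(\<lambda>\<mu>. ?w \<mu> * (indicator ?A \<mu> * g \<mu>) * (indicator ?A \<mu> * h \<mu>)) \<in> borel_measurable ?P"
    by (intro borel_measurable_times joint_density_measurable gm hm)
  also have "(\<lambda>\<mu>. ?w \<mu> * (indicator ?A \<mu> * g \<mu>) * (indicator ?A \<mu> * h \<mu>))
           = (\<lambda>\<mu>. indicator ?A \<mu> *\<^sub>R (?w \<mu> * g \<mu> * h \<mu>))"
    by (auto simp: indicator_def)
  finally have meas: "(\<lambda>\<mu>. indicator ?A \<mu> *\<^sub>R (?w \<mu> * g \<mu> * h \<mu>)) \<in> borel_measurable ?P" .
  have "\<bar>?w \<mu> * g \<mu> * h \<mu>\<bar> \<le> ?w \<mu> * (g \<mu>)\<^sup>2 + ?w \<mu> * (h \<mu>)\<^sup>2" for \<mu>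
  proof -
    have "0 \<le> (\<bar>g \<mu>\<bar> - \<bar>h \<mu>\<bar>)\<^sup>2" by simp
    then have "2 * \<bar>g \<mu> * h \<mu>\<bar> \<le> (g \<mu>)\<^sup>2 + (h \<mu>)\<^sup>2"
      by (simp add: power2_diff abs_mult)
    then have "\<bar>g \<mu> * h \<mu>\<bar> \<le> (g \<mu>)\<^sup>2 + (h \<mu>)\<^sup>2" using abs_ge_zero[of "g \<mu> * h \<mu>"] by linarith
    from mult_left_mono[OF this joint_density_nonneg[OF order_refl]] show ?thesis
      using joint_density_nonneg[OF order_refl, of \<mu>] by (simp add: abs_mult algebra_simps)
  qed
  then have "AE \<mu> in ?P. norm (indicator ?A \<mu> *\<^sub>R (?w \<mu> * g \<mu> * h \<mu>))
        \<le> norm (indicator ?A \<mu> *\<^sub>R (?w \<mu> * (g \<mu>)\<^sup>2 + ?w \<mu> * (h \<mu>)\<^sup>2))"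
    by (auto simp: indicator_def intro: order_trans[OF _ abs_ge_self])
  then show ?thesis
    using Bochner_Integration.integrable_bound[OF bound[unfolded set_integrable_def] meas]
    by (simp add: set_integrable_def)
qed

lemma L2_space_scale:
  assumes "g \<in> L2_space N \<Gamma> \<rho>"
  shows "(\<lambda>\<mu>. a * g \<mu>) \<in> L2_space N \<Gamma> \<rho>"
proof -
  have "(\<lambda>\<mu>. a * (indicator (PiE {1..N} \<Gamma>) \<mu> * g \<mu>)) \<in> borel_measurable (leb {1..N})"
    using assms by (intro borel_measurable_times[OF borel_measurable_const])
      (auto simp: L2_space_def set_borel_measurable_def)
  moreover have "set_integrable (leb {1..N}) (PiE {1..N} \<Gamma>)
      (\<lambda>\<mu>. a\<^sup>2 * (joint_density \<rho> {1..N} \<mu> * (g \<mu>)\<^sup>2))"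
    using assms by (intro set_integrable_mult_right) (auto simp: L2_space_def)
  ultimately show ?thesis
    by (simp add: L2_space_def set_borel_measurable_def power_mult_distrib mult_ac)
qed

lemma L2_space_add:
  assumes "g \<in> L2_space N \<Gamma> \<rho>" and "h \<in> L2_space N \<Gamma> \<rho>"
  shows "(\<lambda>\<mu>. g \<mu> + h \<mu>) \<in> L2_space N \<Gamma> \<rho>"
proof -
  have "(\<lambda>\<mu>. indicator (PiE {1..N} \<Gamma>) \<mu> * g \<mu> + indicator (PiE {1..N} \<Gamma>) \<mu> * h \<mu>)
          \<in> borel_measurable (leb {1..N})"
    using assms by (intro borel_measurable_add) (auto simp: L2_space_def set_borel_measurable_def)
  moreover have "set_integrable (leb {1..N}) (PiE {1..N} \<Gamma>)
      (\<lambda>\<mu>. joint_density \<rho> {1..N} \<mu> * g \<mu> * g \<mu> + joint_density \<rho> {1..N} \<mu> * h \<mu> * h \<mu>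
          + 2 * (joint_density \<rho> {1..N} \<mu> * g \<mu> * h \<mu>))"
    using assms
    by (intro set_integral_add(1) set_integrable_mult_right weighted_product_integrable)
  ultimately show ?thesis
    by (simp add: L2_space_def set_borel_measurable_def power2_eq_square algebra_simps)
qed

lemma L2_space_sum:
  assumes "finite F" and "\<And>i. i \<in> F \<Longrightarrow> e i \<in> L2_space N \<Gamma> \<rho>"
  shows "(\<lambda>\<mu>. \<Sum>i\<in>F. a i * e i \<mu>) \<in> L2_space N \<Gamma> \<rho>"
  using assms
proof (induction F rule: finite_induct)
  case empty
  then show ?case by (simp add: L2_space_def set_borel_measurable_def set_integrable_def)
next
  case (insert i F)
  then show ?case by (simp add: L2_space_add L2_space_scale)
qed

lemma L2_space_diff:
  assumes "g \<in> L2_space N \<Gamma> \<rho>" and "h \<in> L2_space N \<Gamma> \<rho>"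
  shows "(\<lambda>\<mu>. g \<mu> - h \<mu>) \<in> L2_space N \<Gamma> \<rho>"
  using L2_space_add[OF assms(1) L2_space_scale[OF assms(2), of "-1"]] by simp

lemma L2_inner_commute: "L2_inner N \<Gamma> \<rho> g h = L2_inner N \<Gamma> \<rho> h g"
  by (simp add: L2_inner_def mult_ac)

lemma L2_inner_nonneg: "0 \<le> L2_inner N \<Gamma> \<rho> g g"
  unfolding L2_inner_def set_lebesgue_integral_def
  by (intro integral_nonneg_AE AE_I2)
     (simp add: joint_density_nonneg mult.assoc)

lemma L2_inner_diff_left:
  assumes "f \<in> L2_space N \<Gamma> \<rho>" "g \<in> L2_space N \<Gamma> \<rho>" "h \<in> L2_space N \<Gamma> \<rho>"
  shows "L2_inner N \<Gamma> \<rho> (\<lambda>\<mu>. f \<mu> - g \<mu>) h = L2_inner N \<Gamma> \<rho> f h - L2_inner N \<Gamma> \<rho> g h"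
proof -
  have "(\<lambda>\<mu>. joint_density \<rho> {1..N} \<mu> * (f \<mu> - g \<mu>) * h \<mu>) = (\<lambda>\<mu>.
     joint_density \<rho> {1..N} \<mu> * f \<mu> * h \<mu> - joint_density \<rho> {1..N} \<mu> * g \<mu> * h \<mu>)"
    by (auto simp: algebra_simps)
  then show ?thesis
    unfolding L2_inner_def
    by (simp only: set_integral_diff(2)[OF weighted_product_integrable[OF assms(1,3)]
          weighted_product_integrable[OF assms(2,3)]])
qed

lemma L2_inner_sum_left:
  assumes "finite F" and e: "\<And>i. i \<in> F \<Longrightarrow> e i \<in> L2_space N \<Gamma> \<rho>" and h: "h \<in> L2_space N \<Gamma> \<rho>"
  shows "L2_inner N \<Gamma> \<rho> (\<lambda>\<mu>. \<Sum>i\<in>F. a i * e i \<mu>) h = (\<Sum>i\<in>F. a i * L2_inner N \<Gamma> \<rho> (e i) h)"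
proof -
  let ?A = "PiE {1..N} \<Gamma>" and ?w = "joint_density \<rho> {1..N}"
  have "L2_inner N \<Gamma> \<rho> (\<lambda>\<mu>. \<Sum>i\<in>F. a i * e i \<mu>) h
      = (LINT \<mu>|leb {1..N}. (\<Sum>i\<in>F. a i * (indicator ?A \<mu> *\<^sub>R (?w \<mu> * e i \<mu> * h \<mu>))))"
    unfolding L2_inner_def set_lebesgue_integral_def
    by (intro Bochner_Integration.integral_cong)
       (auto simp: sum_distrib_left sum_distrib_right mult_ac)
  also have "\<dots> = (\<Sum>i\<in>F. LINT \<mu>|leb {1..N}. a i * (indicator ?A \<mu> *\<^sub>R (?w \<mu> * e i \<mu> * h \<mu>)))"
    using weighted_product_integrable[OF e h]
    by (intro Bochner_Integration.integral_sum integrable_mult_right)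
       (auto simp: set_integrable_def)
  finally show ?thesis
    by (simp add: L2_inner_def set_lebesgue_integral_def)
qed

section \<open>Fourier series with respect to a complete orthonormal system\<close>

text \<open>Completing the square: the coefficients \<open>c\<close> minimise the distance over all combinations
  supported on \<open>F\<close>, and the minimum decreases as \<open>F\<close> grows.\<close>

lemma L2_inner_residual:
  assumes F: "finite F" and e: "\<And>i. i \<in> F \<Longrightarrow> e i \<in> L2_space N \<Gamma> \<rho>"
    and orth: "\<And>i j. i \<in> F \<Longrightarrow> j \<in> F \<Longrightarrow> L2_inner N \<Gamma> \<rho> (e i) (e j) = (if i = j then 1 else 0)"
    and g: "g \<in> L2_space N \<Gamma> \<rho>"
    and c: "\<And>i. i \<in> F \<Longrightarrow> c i = L2_inner N \<Gamma> \<rho> g (e i)"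
  shows "L2_inner N \<Gamma> \<rho> (\<lambda>\<mu>. g \<mu> - (\<Sum>i\<in>F. a i * e i \<mu>)) (\<lambda>\<mu>. g \<mu> - (\<Sum>i\<in>F. a i * e i \<mu>))
       = L2_inner N \<Gamma> \<rho> g g - (\<Sum>i\<in>F. (c i)\<^sup>2) + (\<Sum>i\<in>F. (c i - a i)\<^sup>2)"
proof -
  let ?S = "\<lambda>\<mu>. \<Sum>i\<in>F. a i * e i \<mu>"
  have S: "?S \<in> L2_space N \<Gamma> \<rho>" by (rule L2_space_sum[OF F e])
  have R: "(\<lambda>\<mu>. g \<mu> - ?S \<mu>) \<in> L2_space N \<Gamma> \<rho>" by (rule L2_space_diff[OF g S])
  have Sg: "L2_inner N \<Gamma> \<rho> ?S g = (\<Sum>i\<in>F. a i * c i)"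
    by (simp add: L2_inner_sum_left[OF F e g] c L2_inner_commute[of g])
  have "L2_inner N \<Gamma> \<rho> ?S (e j) = a j" if "j \<in> F" for j
  proof -
    have "L2_inner N \<Gamma> \<rho> ?S (e j) = (\<Sum>i\<in>F. a i * (if i = j then 1 else 0))"
      using that orth by (simp add: L2_inner_sum_left[OF F e e])
    also have "\<dots> = a j" using F that by (simp add: if_distrib cong: if_cong)
    finally show ?thesis .
  qed
  then have SS: "L2_inner N \<Gamma> \<rho> ?S ?S = (\<Sum>i\<in>F. a i * a i)"
    by (simp only: L2_inner_sum_left[OF F e S] L2_inner_commute[of "e _" ?S] cong: sum.cong)
  have "L2_inner N \<Gamma> \<rho> (\<lambda>\<mu>. g \<mu> - ?S \<mu>) (\<lambda>\<mu>. g \<mu> - ?S \<mu>)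
      = (L2_inner N \<Gamma> \<rho> g g - L2_inner N \<Gamma> \<rho> ?S g)
        - (L2_inner N \<Gamma> \<rho> g ?S - L2_inner N \<Gamma> \<rho> ?S ?S)"
    using L2_inner_diff_left[OF g S R] L2_inner_diff_left[OF g S g] L2_inner_diff_left[OF g S S]
    by (simp add: L2_inner_commute[of g "\<lambda>\<mu>. g \<mu> - ?S \<mu>"] L2_inner_commute[of ?S "\<lambda>\<mu>. g \<mu> - ?S \<mu>"])
  also have "\<dots> = L2_inner N \<Gamma> \<rho> g g - 2 * (\<Sum>i\<in>F. a i * c i) + (\<Sum>i\<in>F. a i * a i)"
    using L2_inner_commute[of g ?S] by (simp add: Sg SS)
  also have "\<dots> = L2_inner N \<Gamma> \<rho> g g - (\<Sum>i\<in>F. (c i)\<^sup>2) + (\<Sum>i\<in>F. (c i - a i)\<^sup>2)"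
    by (simp add: power2_diff sum.distrib sum_subtractf sum_distrib_left algebra_simps
        power2_eq_square)
  finally show ?thesis .
qed

text \<open>Density of the span provides some combination close to \<open>g\<close>.  Its finite support need not lie
  in \<open>J\<close>, but the part outside \<open>J\<close> can be dropped because the optimal coefficients vanish there.\<close>

lemma L2_has_sum_coefficients:
  assumes basis: "complete_orthonormal_basis N \<Gamma> \<rho> e I" and g: "g \<in> L2_space N \<Gamma> \<rho>"
    and J: "J \<subseteq> I" and zero: "\<And>i. i \<in> I - J \<Longrightarrow> L2_inner N \<Gamma> \<rho> g (e i) = 0"
  shows "L2_has_sum N \<Gamma> \<rho> (\<lambda>i \<mu>. L2_inner N \<Gamma> \<rho> g (e i) * e i \<mu>) J g"
proof -
  define c where "c i = L2_inner N \<Gamma> \<rho> g (e i)" for i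
  have e: "e i \<in> L2_space N \<Gamma> \<rho>" if "i \<in> I" for i
    using basis that by (auto simp: complete_orthonormal_basis_def)
  have orth: "L2_inner N \<Gamma> \<rho> (e i) (e j) = (if i = j then 1 else 0)" if "i \<in> I" "j \<in> I" for i j
    using basis that unfolding complete_orthonormal_basis_def by blast
  have residual: "L2_inner N \<Gamma> \<rho> (\<lambda>\<mu>. g \<mu> - (\<Sum>i\<in>F. a i * e i \<mu>)) (\<lambda>\<mu>. g \<mu> - (\<Sum>i\<in>F. a i * e i \<mu>))
       = L2_inner N \<Gamma> \<rho> g g - (\<Sum>i\<in>F. (c i)\<^sup>2) + (\<Sum>i\<in>F. (c i - a i)\<^sup>2)"
    if "finite F" "F \<subseteq> I" for F a
  proof (rule L2_inner_residual[OF that(1) _ _ g])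
    show "e i \<in> L2_space N \<Gamma> \<rho>" if "i \<in> F" for i
      using that \<open>F \<subseteq> I\<close> e by blast
    show "L2_inner N \<Gamma> \<rho> (e i) (e j) = (if i = j then 1 else 0)" if "i \<in> F" "j \<in> F" for i j
      using that \<open>F \<subseteq> I\<close> orth by blast
  qed (simp add: c_def)
  have "((\<lambda>F. L2_norm N \<Gamma> \<rho> (\<lambda>\<mu>. g \<mu> - (\<Sum>i\<in>F. c i * e i \<mu>))) \<longlongrightarrow> 0) (finite_subsets_at_top J)"
  proof (rule tendstoI)
    fix \<epsilon> :: real assume "0 < \<epsilon>"
    then obtain F\<^sub>0 a where F0: "finite F\<^sub>0" "F\<^sub>0 \<subseteq> I"
      and close: "L2_norm N \<Gamma> \<rho> (\<lambda>\<mu>. g \<mu> - (\<Sum>i\<in>F\<^sub>0. a i * e i \<mu>)) < \<epsilon>"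
      using basis g unfolding complete_orthonormal_basis_def by blast
    have "L2_norm N \<Gamma> \<rho> (\<lambda>\<mu>. g \<mu> - (\<Sum>i\<in>F. c i * e i \<mu>)) < \<epsilon>"
      if F: "finite F" "F\<^sub>0 \<inter> J \<subseteq> F" "F \<subseteq> J" for F
    proof -
      have "(\<Sum>i\<in>F\<^sub>0. (c i)\<^sup>2) = (\<Sum>i\<in>F\<^sub>0 \<inter> J. (c i)\<^sup>2)"
        using F0 zero by (intro sum.mono_neutral_right) (auto simp: c_def)
      also have "\<dots> \<le> (\<Sum>i\<in>F. (c i)\<^sup>2)"
        using F by (intro sum_mono2) auto
      finally have "L2_inner N \<Gamma> \<rho> g g - (\<Sum>i\<in>F. (c i)\<^sup>2) + (\<Sum>i\<in>F. (c i - c i)\<^sup>2)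
          \<le> L2_inner N \<Gamma> \<rho> g g - (\<Sum>i\<in>F\<^sub>0. (c i)\<^sup>2) + (\<Sum>i\<in>F\<^sub>0. (c i - a i)\<^sup>2)"
        using sum_nonneg[of F\<^sub>0 "\<lambda>i. (c i - a i)\<^sup>2"] by simp
      then have "L2_norm N \<Gamma> \<rho> (\<lambda>\<mu>. g \<mu> - (\<Sum>i\<in>F. c i * e i \<mu>))
          \<le> L2_norm N \<Gamma> \<rho> (\<lambda>\<mu>. g \<mu> - (\<Sum>i\<in>F\<^sub>0. a i * e i \<mu>))"
        unfolding L2_norm_def using residual[of F c] residual[OF F0, of a] F J
        by (intro real_sqrt_le_mono) auto
      with close show ?thesis by simp
    qed
    then have *: "L2_norm N \<Gamma> \<rho> (\<lambda>\<mu>. g \<mu> - (\<Sum>i\<in>F. c i * e i \<mu>)) < \<epsilon>"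
      if "finite F \<and> F\<^sub>0 \<inter> J \<subseteq> F \<and> F \<subseteq> J" for F
      using that by blast
    show "\<forall>\<^sub>F F in finite_subsets_at_top J.
            dist (L2_norm N \<Gamma> \<rho> (\<lambda>\<mu>. g \<mu> - (\<Sum>i\<in>F. c i * e i \<mu>))) 0 < \<epsilon>"
      unfolding eventually_finite_subsets_at_top
      using F0 * by (intro exI[of _ "F\<^sub>0 \<inter> J"])
        (auto simp: L2_norm_def abs_of_nonneg L2_inner_nonneg)
  qed
  then show ?thesis
    using g J by (auto simp: L2_has_sum_def c_def intro!: L2_space_scale e)
qed

section \<open>Coefficients outside the index set vanish\<close>

text \<open>If the integral over one coordinate \<open>t\<close> is zero for almost every value of the others, Fubini's
  theorem makes the whole inner product zero.\<close>

lemma L2_inner_eq_0_by_slices: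
  assumes t: "t \<in> {1..N}" and g: "g \<in> L2_space N \<Gamma> \<rho>" and h: "h \<in> L2_space N \<Gamma> \<rho>"
    and slice: "AE y in leb ({1..N} - {t}). y \<in> PiE ({1..N} - {t}) \<Gamma> \<longrightarrow>
       0 < joint_density \<rho> ({1..N} - {t}) y \<longrightarrow>
       (LINT s:\<Gamma> t|lborel. \<rho> t s * g (y(t := s)) * h (y(t := s))) = 0"
  shows "L2_inner N \<Gamma> \<rho> g h = 0"
proof -
  let ?K = "{1..N} - {t}"
  interpret product_sigma_finite "\<lambda>_::nat. lborel :: real measure" by standard
  define f where "f \<mu> = indicator (PiE {1..N} \<Gamma>) \<mu> *\<^sub>R (joint_density \<rho> {1..N} \<mu> * g \<mu> * h \<mu>)" for \<mu>
  have ins: "insert t ?K = {1..N}" using t by auto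
  have "integrable (leb (insert t ?K)) f"
    using weighted_product_integrable[OF g h]
    by (simp only: ins f_def[abs_def] set_integrable_def)
  then have "integral\<^sup>L (leb (insert t ?K)) f
      = (LINT y|leb ?K. (LINT s|lborel. f (y(t := s))))"
    by (intro product_integral_insert) auto
  then have "L2_inner N \<Gamma> \<rho> g h = (LINT y|leb ?K. (LINT s|lborel. f (y(t := s))))"
    by (simp only: ins L2_inner_def set_lebesgue_integral_def f_def[abs_def])
  also have "\<dots> = 0"
  proof (rule integral_eq_zero_AE, use slice AE_space in eventually_elim)
    case (elim y)
    have dens: "joint_density \<rho> {1..N} (y(t := s)) = \<rho> t s * joint_density \<rho> ?K y" for s
    proof -
      have "joint_density \<rho> {1..N} (y(t := s))
          = \<rho> t s * (\<Prod>k\<in>?K. \<rho> k ((y(t := s)) k))"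
        unfolding joint_density_def using t by (subst prod.remove[of _ t]) auto
      also have "(\<Prod>k\<in>?K. \<rho> k ((y(t := s)) k)) = joint_density \<rho> ?K y"
        unfolding joint_density_def by (intro prod.cong) auto
      finally show ?thesis .
    qed
    have mem: "y(t := s) \<in> PiE {1..N} \<Gamma> \<longleftrightarrow> y \<in> PiE ?K \<Gamma> \<and> s \<in> \<Gamma> t" for s
      using t elim(2) by (auto simp: PiE_iff space_PiM extensional_def split: if_splits)
    have "f (y(t := s)) = indicator (PiE ?K \<Gamma>) y * joint_density \<rho> ?K y
             * (indicator (\<Gamma> t) s *\<^sub>R (\<rho> t s * g (y(t := s)) * h (y(t := s))))" for s
      unfolding f_def dens indicator_def mem by simp
    then have "(LINT s|lborel. f (y(t := s)))
        = (LINT s|lborel. indicator (PiE ?K \<Gamma>) y * joint_density \<rho> ?K y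
             * (indicator (\<Gamma> t) s *\<^sub>R (\<rho> t s * g (y(t := s)) * h (y(t := s)))))"
      by (simp only:)
    also have "\<dots> = indicator (PiE ?K \<Gamma>) y * joint_density \<rho> ?K y
             * (LINT s:\<Gamma> t|lborel. \<rho> t s * g (y(t := s)) * h (y(t := s)))"
      unfolding set_lebesgue_integral_def by (rule integral_mult_right_zero)
    also have "\<dots> = 0"
    proof (cases "y \<in> PiE ?K \<Gamma> \<and> 0 < joint_density \<rho> ?K y")
      case True
      then show ?thesis using elim(1) by (metis mult_zero_right)
    next
      case False
      have "0 \<le> joint_density \<rho> ?K y" by (rule joint_density_nonneg) auto
      with False have "indicator (PiE ?K \<Gamma>) y * joint_density \<rho> ?K y = 0"
        by (cases "y \<in> PiE ?K \<Gamma>") (simp_all only: indicator_simps, simp_all)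
      then show ?thesis by (simp only: mult_zero_left)
    qed
    finally show ?case .
  qed
  finally show ?thesis .
qed

lemma gpc_basis_split:
  assumes "t \<in> {1..N}"
  shows "gpc_basis N \<phi> i (y(t := s))
       = poly (\<phi> t (i t)) s * (\<Prod>k\<in>{1..N} - {t}. poly (\<phi> k (i k)) (y k))"
proof -
  have "gpc_basis N \<phi> i (y(t := s))
      = poly (\<phi> t (i t)) s * (\<Prod>k\<in>{1..N} - {t}. poly (\<phi> k (i k)) ((y(t := s)) k))"
    unfolding gpc_basis_def using assms by (subst prod.remove[of _ t]) auto
  also have "(\<Prod>k\<in>{1..N} - {t}. poly (\<phi> k (i k)) ((y(t := s)) k))
      = (\<Prod>k\<in>{1..N} - {t}. poly (\<phi> k (i k)) (y k))"
    by (intro prod.cong) auto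
  finally show ?thesis .
qed

text \<open>The function does not involve the coordinate \<open>s\<close>, so on each slice it is a constant tested against
  a polynomial orthogonal to \<open>\<phi> s 0 = 1\<close>.\<close>

lemma L2_inner_eq_0_off_support:
  assumes s: "s \<in> {1..N} - T" and i: "i s \<noteq> 0"
    and polys: "orthonormal_polynomials (\<Gamma> s) (\<rho> s) (\<phi> s)"
    and v: "(\<lambda>\<mu>. v (restrict \<mu> T)) \<in> L2_space N \<Gamma> \<rho>"
    and \<Phi>: "gpc_basis N \<phi> i \<in> L2_space N \<Gamma> \<rho>"
  shows "L2_inner N \<Gamma> \<rho> (\<lambda>\<mu>. v (restrict \<mu> T)) (gpc_basis N \<phi> i) = 0"
proof (rule L2_inner_eq_0_by_slices[of s, OF _ v \<Phi>])
  show s': "s \<in> {1..N}" using s by simp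
  have zero: "(LINT r:\<Gamma> s|lborel. \<rho> s r * poly (\<phi> s (i s)) r) = 0"
  proof -
    have "(LINT r:\<Gamma> s|lborel. \<rho> s r * poly (\<phi> s (i s)) r * poly (\<phi> s 0) r) = 0"
      using polys i unfolding orthonormal_polynomials_def by metis
    moreover have "\<phi> s 0 = 1" using polys by (simp add: orthonormal_polynomials_def)
    ultimately show ?thesis by simp
  qed
  have "(LINT r:\<Gamma> s|lborel. \<rho> s r * v (restrict (y(s := r)) T) * gpc_basis N \<phi> i (y(s := r))) = 0"
    for y
  proof -
    have "restrict (y(s := r)) T = restrict y T" for r
      using s by (auto simp: restrict_def fun_eq_iff)
    then have "(\<lambda>r. \<rho> s r * v (restrict (y(s := r)) T) * gpc_basis N \<phi> i (y(s := r)))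
        = (\<lambda>r. v (restrict y T) * (\<Prod>k\<in>{1..N} - {s}. poly (\<phi> k (i k)) (y k))
             * (\<rho> s r * poly (\<phi> s (i s)) r))"
      by (simp add: gpc_basis_split[OF s'] mult_ac)
    then show ?thesis using zero by simp
  qed
  then show "AE y in leb ({1..N} - {s}). y \<in> PiE ({1..N} - {s}) \<Gamma> \<longrightarrow>
       0 < joint_density \<rho> ({1..N} - {s}) y \<longrightarrow>
       (LINT r:\<Gamma> s|lborel. \<rho> s r * v (restrict (y(s := r)) T) * gpc_basis N \<phi> i (y(s := r))) = 0"
    by simp
qed

text \<open>The image of Lebesgue measure under a projection to fewer coordinates is in general not even
  \<open>\<sigma>\<close>-finite, but the preimage of a null set is its product with the remaining axes, hence null.\<close>

lemma AE_leb_restrict: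
  assumes I: "finite I" and K: "K \<subseteq> I" and P: "AE y in leb K. P y"
  shows "AE y in leb I. P (restrict y K)"
proof -
  interpret product_sigma_finite "\<lambda>_::nat. lborel :: real measure" by standard
  obtain Z where Z: "Z \<in> null_sets (leb K)" and sub: "{y \<in> space (leb K). \<not> P y} \<subseteq> Z"
    using P unfolding eventually_ae_filter by auto
  have restr: "(\<lambda>y. restrict y K) \<in> measurable (leb I) (leb K)"
    by (rule measurable_restrict_subset[OF K])
  have Zm: "Z \<in> sets (leb K)" using Z by auto
  let ?Z' = "(\<lambda>y. restrict y K) -` Z \<inter> space (leb I)"
  have Z'm: "?Z' \<in> sets (leb I)" by (rule measurable_sets[OF restr Zm])
  have un: "K \<union> (I - K) = I" using K by auto
  have "emeasure (leb I) ?Z' = (\<integral>\<^sup>+ y. indicator ?Z' y \<partial>leb (K \<union> (I - K)))"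
    using Z'm by (simp only: un nn_integral_indicator)
  also have "\<dots> = (\<integral>\<^sup>+ a. (\<integral>\<^sup>+ b. indicator ?Z' (merge K (I - K) (a, b)) \<partial>leb (I - K)) \<partial>leb K)"
  proof (rule product_nn_integral_fold)
    show "finite K" by (rule finite_subset[OF K I])
    show "indicator ?Z' \<in> borel_measurable (leb (K \<union> (I - K)))"
      using Z'm by (simp only: un borel_measurable_indicator)
  qed (use I in auto)
  also have "\<dots> = (\<integral>\<^sup>+ a. (\<integral>\<^sup>+ b. indicator Z a \<partial>leb (I - K)) \<partial>leb K)"
  proof (intro nn_integral_cong)
    fix a b assume ab: "a \<in> space (leb K)" "b \<in> space (leb (I - K))"
    have "restrict (merge K (I - K) (a, b)) K = a"
      using ab by (auto simp: space_PiM PiE_iff extensional_def merge_def fun_eq_iff)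
    moreover have "merge K (I - K) (a, b) \<in> space (leb I)"
      using ab K by (auto simp: space_PiM PiE_iff extensional_def merge_def)
    ultimately show "indicator ?Z' (merge K (I - K) (a, b)) = (indicator Z a :: ennreal)"
      by (simp add: indicator_def)
  qed
  also have "\<dots> = (\<integral>\<^sup>+ a. emeasure (leb (I - K)) (space (leb (I - K))) * indicator Z a \<partial>leb K)"
    by (simp add: mult.commute)
  also have "\<dots> = emeasure (leb (I - K)) (space (leb (I - K))) * emeasure (leb K) Z"
    using Zm by (simp add: nn_integral_cmult)
  also have "\<dots> = 0" using Z by auto
  finally have "?Z' \<in> null_sets (leb I)" using Z'm by auto
  moreover have "{y \<in> space (leb I). \<not> P (restrict y K)} \<subseteq> ?Z'"
    using sub measurable_space[OF restr] by auto
  ultimately show ?thesis by (rule AE_I')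
qed

text \<open>Here the basis function is constant in the coordinate \<open>t\<close>, so each slice is a multiple of the
  integral of the component function over \<open>t\<close>.  The hypothesis speaks of almost every point of the
  coordinates in \<open>T - {t}\<close> only and has to be lifted to all coordinates other than \<open>t\<close>.\<close>

lemma L2_inner_eq_0_on_support:
  assumes T: "T \<subseteq> {1..N}" and t: "t \<in> T" and i: "i t = 0" and \<phi>0: "\<phi> t 0 = 1"
    and v: "(\<lambda>\<mu>. v (restrict \<mu> T)) \<in> L2_space N \<Gamma> \<rho>"
    and \<Phi>: "gpc_basis N \<phi> i \<in> L2_space N \<Gamma> \<rho>"
    and mean: "AE y in leb (T - {t}). y \<in> PiE (T - {t}) \<Gamma> \<longrightarrow> 0 < joint_density \<rho> (T - {t}) y \<longrightarrow>
       (LINT s:\<Gamma> t|lborel. \<rho> t s * v (y(t := s))) = 0"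
  shows "L2_inner N \<Gamma> \<rho> (\<lambda>\<mu>. v (restrict \<mu> T)) (gpc_basis N \<phi> i) = 0"
proof (rule L2_inner_eq_0_by_slices[of t, OF _ v \<Phi>])
  show t': "t \<in> {1..N}" using T t by auto
  let ?K = "{1..N} - {t}" and ?L = "T - {t}"
  have "?L \<subseteq> ?K" using T by auto
  from AE_leb_restrict[OF _ this mean]
  have "AE y in leb ?K. restrict y ?L \<in> PiE ?L \<Gamma> \<longrightarrow> 0 < joint_density \<rho> ?L (restrict y ?L) \<longrightarrow>
       (LINT s:\<Gamma> t|lborel. \<rho> t s * v ((restrict y ?L)(t := s))) = 0" by simp
  then show "AE y in leb ?K. y \<in> PiE ?K \<Gamma> \<longrightarrow> 0 < joint_density \<rho> ?K y \<longrightarrow>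
       (LINT s:\<Gamma> t|lborel. \<rho> t s * v (restrict (y(t := s)) T) * gpc_basis N \<phi> i (y(t := s))) = 0"
  proof eventually_elim
    case (elim y)
    show ?case
    proof (intro impI)
      assume y: "y \<in> PiE ?K \<Gamma>" and pos: "0 < joint_density \<rho> ?K y"
      have mem: "restrict y ?L \<in> PiE ?L \<Gamma>" using y \<open>?L \<subseteq> ?K\<close> by auto
      \<comment> \<open>The mean-zero condition is known only where the density of the coordinates in \<open>T - {t}\<close> is
        positive; this holds here because all factors of the larger product are positive.\<close>
      have "\<rho> k (y k) \<noteq> 0" if "k \<in> ?L" for k
        using pos that \<open>?L \<subseteq> ?K\<close>
        unfolding joint_density_def by (metis finite_Diff finite_atLeastAtMost less_irrefl prod_zero subsetD)
      then have "0 < \<rho> k (y k)" if "k \<in> ?L" for k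
        using that T rho_nonneg[of k "y k"] by (metis DiffE order_less_le subsetD)
      then have "0 < joint_density \<rho> ?L (restrict y ?L)"
        unfolding joint_density_def by (intro prod_pos) auto
      with elim mem
      have zero: "(LINT s:\<Gamma> t|lborel. \<rho> t s * v ((restrict y ?L)(t := s))) = 0" by simp
      have "restrict (y(t := s)) T = (restrict y ?L)(t := s)" for s
        using t by (auto simp: restrict_def fun_eq_iff)
      then have "(\<lambda>s. \<rho> t s * v (restrict (y(t := s)) T) * gpc_basis N \<phi> i (y(t := s)))
          = (\<lambda>s. (\<Prod>k\<in>?K. poly (\<phi> k (i k)) (y k)) * (\<rho> t s * v ((restrict y ?L)(t := s))))"
        by (simp add: gpc_basis_split[OF t'] i \<phi>0 mult_ac)
      then show "(LINT s:\<Gamma> t|lborel. \<rho> t s * v (restrict (y(t := s)) T) * gpc_basis N \<phi> i (y(t := s))) = 0"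
        using zero by simp
    qed
  qed
qed

end

section \<open>The expansion of a component function\<close>

theorem theorem1:
  fixes D :: "(real ^ 'd) set"
    and M :: "'w measure"
    and N :: nat
    and X :: "nat \<Rightarrow> 'w \<Rightarrow> real"
    and \<Gamma> :: "nat \<Rightarrow> real set"
    and \<rho> :: "nat \<Rightarrow> real \<Rightarrow> real"
    and \<phi> :: "nat \<Rightarrow> nat \<Rightarrow> real poly"
    and u :: "real ^ 'd \<Rightarrow> (nat \<Rightarrow> real) \<Rightarrow> real"
    and u\<^sub>0 :: "real ^ 'd \<Rightarrow> real"
    and u\<^sub>T :: "nat set \<Rightarrow> real ^ 'd \<Rightarrow> (nat \<Rightarrow> real) \<Rightarrow> real"
    and x :: "real ^ 'd"
    and T :: "nat set"
  assumes dim: "CARD('d) = 2 \<or> CARD('d) = 3"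
    and domain: "polygonal_domain D"
    and prob: "prob_space M"
    and indep: "prob_space.indep_vars M (\<lambda>_. borel) X {1..N}"
    and image: "\<And>k. k \<in> {1..N} \<Longrightarrow> \<Gamma> k = X k ` space M"
    and image_borel: "\<And>k. k \<in> {1..N} \<Longrightarrow> \<Gamma> k \<in> sets borel"
    and density_nonneg: "\<And>k s. k \<in> {1..N} \<Longrightarrow> 0 \<le> \<rho> k s"
    and density: "\<And>k. k \<in> {1..N} \<Longrightarrow> distributed M lborel (X k) (\<lambda>s. ennreal (\<rho> k s))"
    and polys: "\<And>k. k \<in> {1..N} \<Longrightarrow> orthonormal_polynomials (\<Gamma> k) (\<rho> k) (\<phi> k)"
    and basis: "complete_orthonormal_basis N \<Gamma> \<rho> (gpc_basis N \<phi>) (multi_indices N)"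
    and anova: "anova_decomposition N \<Gamma> \<rho> D u u\<^sub>0 u\<^sub>T"
    and x: "x \<in> D"
    and T: "T \<subseteq> {1..N}" "card T > 0"
    and L2: "(\<lambda>\<mu>. u\<^sub>T T x (restrict \<mu> T)) \<in> L2_space N \<Gamma> \<rho>"
  shows "\<exists>c. gpc_expansion N \<Gamma> \<rho> \<phi> (\<lambda>\<mu>. u\<^sub>T T x (restrict \<mu> T)) c \<and>
             (\<forall>i \<in> multi_indices N - multi_indices_on N T. c i = 0) \<and>
             L2_has_sum N \<Gamma> \<rho> (\<lambda>i \<mu>. c i * gpc_basis N \<phi> i \<mu>) (multi_indices_on N T)
               (\<lambda>\<mu>. u\<^sub>T T x (restrict \<mu> T)) \<and>
             (\<forall>i \<in> multi_indices_on N T.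
                c i = (LINT \<mu>:PiE {1..N} \<Gamma>|leb {1..N}.
                         joint_density \<rho> {1..N} \<mu> * u\<^sub>T T x (restrict \<mu> T) * gpc_basis N \<phi> i \<mu>))"
proof -
  let ?g = "\<lambda>\<mu>. u\<^sub>T T x (restrict \<mu> T)"
  interpret product_weight N \<Gamma> \<rho>
  proof
    fix k s assume k: "k \<in> {1..N}"
    show "\<Gamma> k \<in> sets borel" by (rule image_borel[OF k])
    show "0 \<le> \<rho> k s" by (rule density_nonneg[OF k])
    have "(\<lambda>s. ennreal (\<rho> k s)) \<in> borel_measurable borel"
      using density[OF k] by (simp add: distributed_def)
    then have "(\<lambda>s. enn2real (ennreal (\<rho> k s))) \<in> borel_measurable borel" by measurable
    then show "\<rho> k \<in> borel_measurable borel" by (simp add: density_nonneg[OF k])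
  qed
  define c where "c i = L2_inner N \<Gamma> \<rho> ?g (gpc_basis N \<phi> i)" for i
  have zero: "c i = 0" if i: "i \<in> multi_indices N - multi_indices_on N T" for i
  proof -
    have \<Phi>: "gpc_basis N \<phi> i \<in> L2_space N \<Gamma> \<rho>"
      using basis i by (auto simp: complete_orthonormal_basis_def)
    consider t where "t \<in> T" "i t = 0" | s where "s \<in> {1..N} - T" "i s \<noteq> 0"
      using i by (auto simp: multi_indices_on_def)
    then show ?thesis
    proof cases
      case (1 t)
      then have "\<phi> t 0 = 1"
        using polys[of t] T(1) by (auto simp: orthonormal_polynomials_def)
      moreover have "AE y in leb (T - {t}). y \<in> PiE (T - {t}) \<Gamma> \<longrightarrow>
          0 < joint_density \<rho> (T - {t}) y \<longrightarrow>
          (LINT s:\<Gamma> t|lborel. \<rho> t s * u\<^sub>T T x (y(t := s))) = 0"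
      proof -
        have "AE y in leb (T - {t}). y \<in> PiE (T - {t}) \<Gamma> \<longrightarrow> 0 < joint_density \<rho> (T - {t}) y \<longrightarrow>
            set_integrable lborel (\<Gamma> t) (\<lambda>s. \<rho> t s * u\<^sub>T T x (y(t := s))) \<and>
            (LINT s:\<Gamma> t|lborel. \<rho> t s * u\<^sub>T T x (y(t := s))) = 0"
          using anova x T(1) 1(1) unfolding anova_decomposition_def by blast
        then show ?thesis by eventually_elim blast
      qed
      ultimately show ?thesis
        unfolding c_def using L2_inner_eq_0_on_support[OF T(1) 1 _ L2 \<Phi>] by blast
    next
      case (2 s)
      then show ?thesis
        unfolding c_def using polys[of s] by (intro L2_inner_eq_0_off_support[OF _ _ _ L2 \<Phi>]) auto
    qed
  qed
  have "L2_has_sum N \<Gamma> \<rho> (\<lambda>i \<mu>. c i * gpc_basis N \<phi> i \<mu>) (multi_indices N) ?g"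
    unfolding c_def by (rule L2_has_sum_coefficients[OF basis L2]) auto
  moreover have "L2_has_sum N \<Gamma> \<rho> (\<lambda>i \<mu>. c i * gpc_basis N \<phi> i \<mu>) (multi_indices_on N T) ?g"
    unfolding c_def using zero
    by (intro L2_has_sum_coefficients[OF basis L2]) (auto simp: c_def multi_indices_on_def)
  ultimately show ?thesis
    using zero by (intro exI[of _ c]) (simp add: gpc_expansion_def c_def L2_inner_def)
qed

end
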